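(* For every integer $\ell \ge 2$, $\tilde{r}(K_{1,3}, P_{\ell}) = \lfloor 3\ell/2 \rfloor$.
   Context: Given graphs $G$ and $H$, the $(G,H)$-online Ramsey game is played between two players, Builder and Painter, starting from an infinite set of isolated vertices. In each round Builder draws an edge between two nonadjacent vertices, and Painter immediately colors it red or blue. Builder's goal is to force either a red copy of $G$ or a blue copy of $H$ in as few rounds as possible; Painter's goal is to delay this as long as possible. The online Ramsey number $\tilde{r}(G,H)$ is the smallest number of rounds in which Builder can always guarantee a red copy of $G$ or a blue copy of $H$, assuming both players play optimally. $K_{1,3}$ denotes the star with three edges, and $P_\ell$ denotes the path with $\ell$ vertices. *)

theory Defs
  imports Main "HOL-Library.Extended_Nat"
begin

text \<open>A graph is a pair of a vertex set and a set of edges, each edge being a two-element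
  vertex set.\<close>

type_synonym 'a ugraph = "'a set \<times> 'a set set"

definition star :: "nat \<Rightarrow> nat ugraph" where
  "star k = ({0..k}, {{0, i} | i. i \<in> {1..k}})"

text \<open>The parameter of \<open>path_graph\<close> is the number of vertices, not of edges.\<close>

definition path_graph :: "nat \<Rightarrow> nat ugraph" where
  "path_graph l = ({..<l}, {{i, Suc i} | i. Suc i < l})"

text \<open>The board is the infinite vertex set \<open>UNIV :: nat set\<close>. Copies are subgraphs, not
  necessarily induced, of the graph whose edges are the members of \<open>C\<close>.\<close>

definition has_copy :: "'a ugraph \<Rightarrow> nat set set \<Rightarrow> bool" where
  "has_copy G C \<longleftrightarrow> (\<exists>f :: 'a \<Rightarrow> nat. inj_on f (fst G) \<and> (\<forall>e \<in> snd G. f ` e \<in> C))"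

text \<open>\<open>builder_forces G H n R B\<close>: from the position with red edges \<open>R\<close> and blue edges \<open>B\<close>,
  Builder can force a red copy of \<open>G\<close> or a blue copy of \<open>H\<close> within at most \<open>n\<close> further rounds.
  In each round Builder picks an undrawn edge (the existential quantifier) and then Painter picks
  its colour, so that Builder must succeed after either answer (the conjunction).\<close>

primrec builder_forces ::
  "'a ugraph \<Rightarrow> 'b ugraph \<Rightarrow> nat \<Rightarrow> nat set set \<Rightarrow> nat set set \<Rightarrow> bool" where
  "builder_forces G H 0 R B \<longleftrightarrow> has_copy G R \<or> has_copy H B"
| "builder_forces G H (Suc n) R B \<longleftrightarrow>
     has_copy G R \<or> has_copy H B \<or>
     (\<exists>u v. u \<noteq> v \<and> {u, v} \<notin> R \<union> B \<and>
        builder_forces G H n (insert {u, v} R) B \<and>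
        builder_forces G H n R (insert {u, v} B))"

text \<open>The value is \<open>\<infinity>\<close> if Builder cannot force a win in any bounded number of rounds.\<close>

definition online_ramsey :: "'a ugraph \<Rightarrow> 'b ugraph \<Rightarrow> enat" where
  "online_ramsey G H = Inf {enat n | n. builder_forces G H n {} {}}"

end

theory Submission
  imports Defs
begin

text \<open>Builder: if Painter answers red, Builder extends a red path, whose inner vertices have two red
  edges each and hence yield two forced blue edges each; this costs three rounds per two blue edges.
  A blue answer ends the red path, and a second blue edge at the same red end makes up for the loss.
  Short red paths need separate treatment because their inner vertices are adjacent to the vertices
  that one would like to join them to.

  Painter: colouring red whenever no red degree 3 and no red cycle arises makes Builder pay about one
  red edge for every two edges of the blue path. The rounding for even \<open>l\<close> requires one exception:
  a red cycle may be closed once there are \<open>l div 2\<close> red edges.\<close>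

section \<open>Builder's strategy\<close>

declare builder_forces.simps [simp del]

section \<open>Red degrees, blue paths and copies of the two target graphs\<close>

definition touched :: "nat set set \<Rightarrow> nat \<Rightarrow> bool" where
  "touched R x \<longleftrightarrow> (\<exists>a. a \<noteq> x \<and> {x, a} \<in> R)"

text \<open>Red degree at least 2, expressed by witnesses so that it passes to larger
  \<open>R\<close> without a cardinality argument; \<open>a \<noteq> x\<close> and
  \<open>b \<noteq> x\<close> exclude singletons posing as edges.\<close>

definition saturated :: "nat set set \<Rightarrow> nat \<Rightarrow> bool" where
  "saturated R x \<longleftrightarrow> (\<exists>a b. a \<noteq> b \<and> a \<noteq> x \<and> b \<noteq> x \<and> {x, a} \<in> R \<and> {x, b} \<in> R)"

definition blue_path :: "nat set set \<Rightarrow> nat list \<Rightarrow> bool" where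
  "blue_path B p \<longleftrightarrow> distinct p \<and> successively (\<lambda>a b. {a, b} \<in> B) p"

abbreviation wins :: "nat \<Rightarrow> nat \<Rightarrow> nat set set \<Rightarrow> nat set set \<Rightarrow> bool" where
  "wins l \<equiv> builder_forces (star 3) (path_graph l)"

lemma touched_insert: "touched R x \<Longrightarrow> touched (insert e R) x"
  unfolding touched_def by blast

lemma saturated_insert: "saturated R x \<Longrightarrow> saturated (insert e R) x"
  unfolding saturated_def by blast

lemma touched_new: "x \<noteq> a \<Longrightarrow> touched (insert {x, a} R) x" "x \<noteq> a \<Longrightarrow> touched (insert {a, x} R) x"
  unfolding touched_def by (auto simp: doubleton_eq_iff)

lemma saturated_new:
  assumes "touched R x" "{x, a} \<notin> R" "x \<noteq> a"
  shows "saturated (insert {x, a} R) x" "saturated (insert {a, x} R) x"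
proof -
  obtain b where "b \<noteq> x" "{x, b} \<in> R"
    using assms(1) unfolding touched_def by blast
  with assms show "saturated (insert {x, a} R) x"
    unfolding saturated_def by (intro exI[of _ a] exI[of _ b]) auto
  then show "saturated (insert {a, x} R) x"
    by (simp add: insert_commute)
qed

lemma blue_path_insert: "blue_path B p \<Longrightarrow> blue_path (insert e B) p"
  unfolding blue_path_def by (auto elim: successively_mono)

lemma blue_path_Cons:
  "blue_path B (a # b # p) \<longleftrightarrow> a \<notin> set (b # p) \<and> {a, b} \<in> B \<and> blue_path B (b # p)"
  unfolding blue_path_def by auto

lemma blue_path_rev: "blue_path B (rev p) \<longleftrightarrow> blue_path B p"
  unfolding blue_path_def by (simp add: insert_commute)

lemma has_copy_star_insert:
  assumes "saturated R x" "x \<noteq> a" "{x, a} \<notin> R"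
  shows "has_copy (star 3) (insert {x, a} R)"
proof -
  obtain b c where bc: "b \<noteq> c" "b \<noteq> x" "c \<noteq> x" "{x, b} \<in> R" "{x, c} \<in> R"
    using assms(1) unfolding saturated_def by blast
  define f where "f = (\<lambda>i::nat. if i = 0 then x else if i = 1 then a else if i = 2 then b else c)"
  have "a \<noteq> b" "a \<noteq> c" using assms bc by auto
  have "{0..3::nat} = {0, 1, 2, 3}" by auto
  with bc assms \<open>a \<noteq> b\<close> \<open>a \<noteq> c\<close> have "inj_on f {0..3}"
    by (auto simp: f_def)
  moreover have "f ` {0, i} \<in> insert {x, a} R" if "i \<in> {1..3}" for i
  proof -
    from that have "i = 1 \<or> i = 2 \<or> i = 3" by auto
    then show ?thesis using bc by (auto simp: f_def)
  qed
  ultimately show ?thesis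
    unfolding has_copy_def star_def fst_conv snd_conv by (intro exI[of _ f] conjI) blast+
qed

lemma has_copy_path_graph:
  assumes "blue_path B p" "l \<le> length p"
  shows "has_copy (path_graph l) B"
proof -
  have "inj_on (nth p) {..<l}"
    using assms unfolding blue_path_def by (auto simp: inj_on_def nth_eq_iff_index_eq)
  moreover have "nth p ` {i, Suc i} \<in> B" if "Suc i < l" for i
    using assms that unfolding blue_path_def by (auto simp: successively_conv_nth)
  ultimately show ?thesis
    unfolding has_copy_def path_graph_def by auto
qed

section \<open>Monotonicity and single moves of Builder\<close>

lemma builder_forces_done:
  "has_copy G R \<or> has_copy H B \<Longrightarrow> builder_forces G H n R B"
  by (cases n) (auto simp: builder_forces.simps)

lemma builder_forces_mono:
  "builder_forces G H m R B \<Longrightarrow> m \<le> n \<Longrightarrow> builder_forces G H n R B"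
proof (induction m arbitrary: n R B)
  case 0
  then show ?case by (simp add: builder_forces_done builder_forces.simps)
next
  case (Suc m)
  then obtain k where "n = Suc k" "m \<le> k" by (cases n) auto
  with Suc show ?case by (simp add: builder_forces.simps) blast
qed

lemma wins_path: "blue_path B p \<Longrightarrow> l \<le> length p \<Longrightarrow> wins l n R B"
  by (intro builder_forces_done disjI2 has_copy_path_graph)

text \<open>The form \<open>n - 1\<close> with \<open>0 < n\<close> admits budgets given by
  \<open>div\<close> expressions, without rewriting them as successors.\<close>

lemma wins_draw:
  assumes "wins l (n - 1) (insert {u, v} R) B" "wins l (n - 1) R (insert {u, v} B)"
    and "u \<noteq> v" "{u, v} \<notin> R \<union> B" "0 < n"
  shows "wins l n R B"
  using assms by (cases n) (auto simp: builder_forces.simps)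

text \<open>A red answer would be the third red edge at a saturated endpoint and complete the star,
  so only the blue branch goes on.\<close>

lemma wins_forced:
  assumes "wins l (n - 1) R (insert {u, v} B)"
    and "saturated R u \<or> saturated R v" "u \<noteq> v" "{u, v} \<notin> R \<union> B" "0 < n"
  shows "wins l n R B"
proof (rule wins_draw)
  have "has_copy (star 3) (insert {u, v} R)"
    using assms has_copy_star_insert[of R u v] has_copy_star_insert[of R v u]
    by (auto simp: insert_commute)
  then show "wins l (n - 1) (insert {u, v} R) B"
    by (intro builder_forces_done) simp
qed (use assms in auto)

text \<open>In the four predicates below, \<open>x\<close> is an end of a blue path that still lacks \<open>q\<close>
  edges. Two red edges at a vertex force all further edges there to be blue, so red edges at \<open>x\<close>
  lower the number of rounds needed.\<close>

definition plain_end :: "nat \<Rightarrow> nat \<Rightarrow> bool" where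
  "plain_end l q \<longleftrightarrow> (\<forall>R B x p. finite (\<Union>R \<union> \<Union>B) \<longrightarrow> blue_path B (x # p) \<longrightarrow>
     l \<le> length (x # p) + q \<longrightarrow> wins l (3 * q div 2 + 2) R B)"

definition touched_end :: "nat \<Rightarrow> nat \<Rightarrow> bool" where
  "touched_end l q \<longleftrightarrow> (\<forall>R B x p. finite (\<Union>R \<union> \<Union>B) \<longrightarrow> blue_path B (x # p) \<longrightarrow>
     touched R x \<longrightarrow>
     l \<le> length (x # p) + q \<longrightarrow> wins l (3 * (q + 1) div 2) R B)"

definition saturated_end :: "nat \<Rightarrow> nat \<Rightarrow> bool" where
  "saturated_end l q \<longleftrightarrow> (\<forall>R B x p y. finite (\<Union>R \<union> \<Union>B) \<longrightarrow> blue_path B (x # p) \<longrightarrow>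
     saturated R x \<longrightarrow> touched R y \<longrightarrow> y \<notin> set (x # p) \<longrightarrow>
     l \<le> length (x # p) + q \<longrightarrow> wins l ((3 * q + 1) div 2) R B)"

text \<open>The blue edge \<open>{s, t}\<close> is kept in reserve: since \<open>s\<close> is saturated it can be appended to
  the blue path at any time, leaving the touched vertex \<open>t\<close> as the new end. Reached only with
  \<open>q\<close> odd and at least \<open>3\<close>, so that the truncated subtraction is harmless.\<close>

definition reserve_end :: "nat \<Rightarrow> nat \<Rightarrow> bool" where
  "reserve_end l q \<longleftrightarrow> (\<forall>R B x p y s t. finite (\<Union>R \<union> \<Union>B) \<longrightarrow> blue_path B (x # p) \<longrightarrow>
     saturated R x \<longrightarrow> touched R y \<longrightarrow> saturated R s \<longrightarrow> touched R t \<longrightarrow> {s, t} \<in> B \<longrightarrow>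
     distinct [y, s, t] \<longrightarrow> set [y, s, t] \<inter> set (x # p) = {} \<longrightarrow>
     l \<le> length (x # p) + q \<longrightarrow> wins l ((3 * q - 5) div 2) R B)"

text \<open>Six consecutive numbers above everything drawn or in \<open>X\<close>;
  \<open>plain_end_odd\<close> uses all six. Both orientations are given so that the simplifier can
  discharge the side conditions of each move.\<close>

lemma fresh_vertices:
  fixes R B :: "nat set set" and X :: "nat set"
  assumes "finite (\<Union>R \<union> \<Union>B)" "finite X"
  obtains a b c d e f where "distinct [a, b, c, d, e, f]" "distinct [f, e, d, c, b, a]"
    "\<forall>v\<in>{a, b, c, d, e, f}. v \<notin> X \<and> (\<forall>w\<in>X. w \<noteq> v)"
    "\<forall>v\<in>{a, b, c, d, e, f}. \<forall>w. {v, w} \<notin> R \<and> {w, v} \<notin> R \<and> {v, w} \<notin> B \<and> {w, v} \<notin> B"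
proof -
  have "finite (\<Union>R \<union> \<Union>B \<union> X)"
    using assms by simp
  then obtain m where m: "\<And>v. v \<in> \<Union>R \<union> \<Union>B \<union> X \<Longrightarrow> v < m"
    using finite_nat_set_iff_bounded by metis
  have "v \<notin> X \<and> (\<forall>w\<in>X. w \<noteq> v)" if "m \<le> v" for v
    using m that by fastforce
  moreover have "{v, w} \<notin> R \<and> {w, v} \<notin> R \<and> {v, w} \<notin> B \<and> {w, v} \<notin> B" if "m \<le> v" for v w
  proof -
    have "v \<notin> \<Union>R" "v \<notin> \<Union>B"
      using m[of v] that by auto
    then show ?thesis by auto
  qed
  ultimately show ?thesis
    by (intro that[of m "m + 1" "m + 2" "m + 3" "m + 4" "m + 5"]) simp_all
qed

lemma plain_endD:
  assumes "plain_end l q" "finite (\<Union>R \<union> \<Union>B)" "blue_path B (x # p)" "l \<le> length (x # p) + q"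
    "3 * q div 2 + 2 \<le> n"
  shows "wins l n R B"
  by (rule builder_forces_mono[OF assms(1)[unfolded plain_end_def, rule_format, OF assms(2-4)] assms(5)])

lemma touched_endD:
  assumes "touched_end l q" "finite (\<Union>R \<union> \<Union>B)" "blue_path B (x # p)" "touched R x"
    "l \<le> length (x # p) + q" "3 * (q + 1) div 2 \<le> n"
  shows "wins l n R B"
  by (rule builder_forces_mono[OF assms(1)[unfolded touched_end_def, rule_format, OF assms(2-5)] assms(6)])

lemma saturated_endD:
  assumes "saturated_end l q" "finite (\<Union>R \<union> \<Union>B)" "blue_path B (x # p)"
    "saturated R x" "touched R y" "y \<notin> set (x # p)"
    "l \<le> length (x # p) + q" "(3 * q + 1) div 2 \<le> n"
  shows "wins l n R B"
  by (rule builder_forces_mono[OF assms(1)[unfolded saturated_end_def, rule_format, OF assms(2-7)] assms(8)])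

lemma reserve_endD:
  assumes "reserve_end l q" "finite (\<Union>R \<union> \<Union>B)" "blue_path B (x # p)"
    "saturated R x" "touched R y" "saturated R s" "touched R t" "{s, t} \<in> B"
    "distinct [y, s, t]" "set [y, s, t] \<inter> set (x # p) = {}"
    "l \<le> length (x # p) + q" "(3 * q - 5) div 2 \<le> n"
  shows "wins l n R B"
  by (rule builder_forces_mono[OF assms(1)[unfolded reserve_end_def, rule_format, OF assms(2-11)] assms(12)])

section \<open>Recursion between the kinds of path ends\<close>

lemmas game_simps = blue_path_Cons blue_path_insert touched_insert saturated_insert touched_new
  saturated_new doubleton_eq_iff

text \<open>Builder draws from \<open>y\<close> to new vertices. Once \<open>y\<close> is saturated,
  it is linked to \<open>x\<close> through one vertex and becomes the new end, its newest red
  neighbour taking over the role of \<open>y\<close>: two blue edges in three rounds. Two blue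
  answers instead give three blue edges in three rounds, but with a fresh vertex as end.\<close>

lemma saturated_end_if:
  assumes "\<And>q'. q' + 3 \<le> q \<Longrightarrow> plain_end l q'"
  shows "saturated_end l q"
  using assms
proof (induction q rule: less_induct)
  case (less q)
  show ?case
    unfolding saturated_end_def
  proof (intro allI impI)
    fix R B x p y
    assume fin: "finite (\<Union>R \<union> \<Union>B)" and path: "blue_path B (x # p)"
      and x: "saturated R x" and y: "touched R y" "y \<notin> set (x # p)"
      and l: "l \<le> length (x # p) + q"
    obtain z u w and r1 r2 r3 :: nat where new:
      "distinct [z, u, w, r1, r2, r3]" "distinct [r3, r2, r1, w, u, z]"
      "\<forall>i\<in>{z, u, w, r1, r2, r3}. i \<notin> set (y # x # p) \<and> (\<forall>j\<in>set (y # x # p). j \<noteq> i)"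
      "\<forall>i\<in>{z, u, w, r1, r2, r3}. \<forall>j. {i, j} \<notin> R \<and> {j, i} \<notin> R \<and> {i, j} \<notin> B \<and> {j, i} \<notin> B"
      by (rule fresh_vertices[OF fin List.finite_set, of "y # x # p"])
    have neq: "y \<noteq> x" "x \<noteq> y" "y \<notin> set p"
      using y by auto
    note ctx = fin[simplified] path x y neq new[simplified] game_simps less.prems
    show "wins l ((3 * q + 1) div 2) R B"
    proof (cases "q \<le> 1")
      case True
      show ?thesis
      proof (cases "q = 0")
        case True
        with l path show ?thesis by (auto intro: wins_path)
      next
        case False
        with True have "q = 1" by simp
        then show ?thesis
          by - (rule wins_forced[of _ _ _ x z, OF wins_path[of _ "z # x # p"]],
              use l in \<open>simp_all add: ctx\<close>)
      qed
    next
      case False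
      note q = l False
      let ?n = "(3 * q + 1) div 2"
      note IH = saturated_endD[OF less.IH[of "q - 2"]]
      \<comment> \<open>Nested \<open>wins_forced\<close>, read from the outside in, are the forced
        blue edges in order of play.\<close>
      have red: "wins l (?n - 1) (insert {y, z} R) B"
        by (rule wins_forced[of _ _ _ x w, OF wins_forced[of _ _ _ w y, OF
              IH[of _ _ y "w # x # p" z]]])
          (use q in \<open>simp_all add: ctx\<close>)
      have blue_red: "wins l (?n - 1 - 1) (insert {y, u} R) (insert {y, z} B)"
        by (rule wins_forced[of _ _ _ x z, OF IH[of _ _ y "z # x # p" u]])
          (use q in \<open>simp_all add: ctx\<close>)
      have blue_blue: "wins l (?n - 1 - 1) R (insert {y, u} (insert {y, z} B))"
      proof (cases "q = 2")
        case True
        then show ?thesis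
          by - (rule wins_forced[of _ _ _ x z, OF wins_path[of _ "y # z # x # p"]],
              use q in \<open>simp_all add: ctx\<close>)
      next
        case False
        with q show ?thesis
          by - (rule wins_forced[of _ _ _ x z, OF plain_endD[of _ "q - 3" _ _ u "y # z # x # p"]],
              use q in \<open>simp_all add: ctx\<close>)
      qed
      have "wins l (?n - 1) R (insert {y, z} B)"
        by (rule wins_draw[OF blue_red blue_blue]) (use q in \<open>simp_all add: ctx\<close>)
      with red show ?thesis
        by (rule wins_draw) (use q in \<open>simp_all add: ctx\<close>)
    qed
  qed
qed

text \<open>One more edge at \<open>x\<close> decides: red saturates \<open>x\<close> and makes
  \<open>y\<close> the touched vertex, blue extends the path. Both continuations use the budget
  exactly.\<close>

lemma touched_end_if:
  assumes "\<And>q'. q' < q \<Longrightarrow> plain_end l q'"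
  shows "touched_end l q"
  unfolding touched_end_def
proof (intro allI impI)
  fix R B x p
  assume fin: "finite (\<Union>R \<union> \<Union>B)" and path: "blue_path B (x # p)"
    and x: "touched R x" and l: "l \<le> length (x # p) + q"
  obtain y and r1 r2 r3 r4 r5 :: nat where new:
    "distinct [y, r1, r2, r3, r4, r5]" "distinct [r5, r4, r3, r2, r1, y]"
    "\<forall>i\<in>{y, r1, r2, r3, r4, r5}. i \<notin> set (x # p) \<and> (\<forall>j\<in>set (x # p). j \<noteq> i)"
    "\<forall>i\<in>{y, r1, r2, r3, r4, r5}. \<forall>j. {i, j} \<notin> R \<and> {j, i} \<notin> R \<and> {i, j} \<notin> B \<and> {j, i} \<notin> B"
    by (rule fresh_vertices[OF fin List.finite_set, of "x # p"])
  note ctx = fin[simplified] path x new[simplified] game_simps assms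
  show "wins l (3 * (q + 1) div 2) R B"
  proof (cases "q = 0")
    case True
    with l path show ?thesis by (auto intro: wins_path)
  next
    case False
    note q = False l
    have "wins l (3 * (q + 1) div 2 - 1) (insert {x, y} R) B"
      by (rule saturated_endD[OF saturated_end_if, of q _ _ _ x p y])
        (use q in \<open>simp_all add: ctx\<close>)
    moreover have "wins l (3 * (q + 1) div 2 - 1) R (insert {x, y} B)"
      by (rule plain_endD[of _ "q - 1" _ _ y "x # p"]) (use q in \<open>simp_all add: ctx\<close>)
    ultimately show ?thesis
      by (rule wins_draw) (use q in \<open>simp_all add: ctx\<close>)
  qed
qed

text \<open>The play is that of \<open>saturated_end\<close> until the path is linked to
  \<open>s\<close>, which collects \<open>{s, t}\<close> without a further round. As
  \<open>q - 5\<close> is even, the rounding down in the budget of \<open>touched_end\<close> makes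
  the sum fit.\<close>

lemma reserve_end_if:
  assumes "\<And>q'. q' < q \<Longrightarrow> plain_end l q'" "odd q" "3 \<le> q"
  shows "reserve_end l q"
  using assms
proof (induction q rule: less_induct)
  case (less q)
  show ?case
    unfolding reserve_end_def
  proof (intro allI impI)
    fix R B x p y s t
    assume fin: "finite (\<Union>R \<union> \<Union>B)" and path: "blue_path B (x # p)"
      and x: "saturated R x" and y: "touched R y" and s: "saturated R s" and t: "touched R t"
      and st: "{s, t} \<in> B" and dist: "distinct [y, s, t]" "set [y, s, t] \<inter> set (x # p) = {}"
      and l: "l \<le> length (x # p) + q"
    obtain u v w and r1 r2 r3 :: nat where new:
      "distinct [u, v, w, r1, r2, r3]" "distinct [r3, r2, r1, w, v, u]"
      "\<forall>i\<in>{u, v, w, r1, r2, r3}. i \<notin> set (y # s # t # x # p) \<and> (\<forall>j\<in>set (y # s # t # x # p). j \<noteq> i)"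
      "\<forall>i\<in>{u, v, w, r1, r2, r3}. \<forall>j. {i, j} \<notin> R \<and> {j, i} \<notin> R \<and> {i, j} \<notin> B \<and> {j, i} \<notin> B"
      by (rule fresh_vertices[OF fin List.finite_set, of "y # s # t # x # p"])
    have neq: "distinct [x, y, s, t]" "distinct [t, s, y, x]" "y \<notin> set p" "s \<notin> set p" "t \<notin> set p"
      using dist by auto
    have "{t, s} \<in> B"
      using st by (simp add: insert_commute)
    note ctx = fin[simplified] path x y s t st this neq[simplified] new[simplified] game_simps less.prems(1)
    let ?n = "(3 * q - 5) div 2"
    show "wins l ?n R B"
    proof (cases "q = 3")
      case True
      then show ?thesis
        by - (rule wins_forced[of _ _ _ x w, OF wins_forced[of _ _ _ w s, OF
              wins_path[of _ "t # s # w # x # p"]]],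
            use l in \<open>simp_all add: ctx\<close>)
    next
      case False
      with less.prems have "5 \<le> q" by presburger
      note q = this l less.prems(2)
      note IH = reserve_endD[OF less.IH[of "q - 2"]]
      have red: "wins l (?n - 1) (insert {y, u} R) B"
        by (rule wins_forced[of _ _ _ x w, OF wins_forced[of _ _ _ w y, OF
              IH[of _ _ y "w # x # p" u s t]]])
          (use q in \<open>simp_all add: ctx\<close>)
      have blue_red: "wins l (?n - 1 - 1) (insert {y, v} R) (insert {y, u} B)"
        by (rule wins_forced[of _ _ _ x u, OF IH[of _ _ y "u # x # p" v s t]])
          (use q in \<open>simp_all add: ctx\<close>)
      \<comment> \<open>Four rounds give five edges: \<open>{y, u}\<close>, \<open>{y, v}\<close>,
        \<open>{x, u}\<close>, \<open>{v, s}\<close> and the reserve edge; \<open>t\<close> is the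
        new end.\<close>
      have blue_blue: "wins l (?n - 1 - 1) R (insert {y, v} (insert {y, u} B))"
        by (rule wins_forced[of _ _ _ x u, OF wins_forced[of _ _ _ v s, OF
              touched_endD[OF touched_end_if, of "q - 5" _ _ _ t "s # v # y # u # x # p"]]])
          (use q in \<open>simp_all add: ctx\<close>, presburger)
      have "wins l (?n - 1) R (insert {y, u} B)"
        by (rule wins_draw[OF blue_red blue_blue]) (use q in \<open>simp_all add: ctx\<close>)
      with red show ?thesis
        by (rule wins_draw) (use q in \<open>simp_all add: ctx\<close>)
    qed
  qed
qed

text \<open>Two red edges saturate \<open>x\<close>, and for even \<open>q\<close> the budget of
  \<open>saturated_end\<close> is exactly two rounds smaller. For odd \<open>q\<close> the
  difference is only one, so this opening would be too slow.\<close>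

lemma plain_end_even:
  assumes "\<And>q'. q' < q \<Longrightarrow> plain_end l q'" "even q"
  shows "plain_end l q"
  unfolding plain_end_def
proof (intro allI impI)
  fix R B x p
  assume fin: "finite (\<Union>R \<union> \<Union>B)" and path: "blue_path B (x # p)"
    and l: "l \<le> length (x # p) + q"
  obtain y z and r1 r2 r3 r4 :: nat where new:
    "distinct [y, z, r1, r2, r3, r4]" "distinct [r4, r3, r2, r1, z, y]"
    "\<forall>i\<in>{y, z, r1, r2, r3, r4}. i \<notin> set (x # p) \<and> (\<forall>j\<in>set (x # p). j \<noteq> i)"
    "\<forall>i\<in>{y, z, r1, r2, r3, r4}. \<forall>j. {i, j} \<notin> R \<and> {j, i} \<notin> R \<and> {i, j} \<notin> B \<and> {j, i} \<notin> B"
    by (rule fresh_vertices[OF fin List.finite_set, of "x # p"])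
  note ctx = fin[simplified] path new[simplified] game_simps assms(1)
  let ?n = "3 * q div 2 + 2"
  show "wins l ?n R B"
  proof (cases "q = 0")
    case True
    with l path show ?thesis by (auto intro: wins_path)
  next
    case False
    note q = False l assms(2)
    have red_red: "wins l (?n - 1 - 1) (insert {x, z} (insert {x, y} R)) B"
      by (rule saturated_endD[OF saturated_end_if, of q _ _ _ x p y])
        (use q in \<open>simp_all add: ctx\<close>)
    have red_blue: "wins l (?n - 1 - 1) (insert {x, y} R) (insert {x, z} B)"
      by (rule plain_endD[of _ "q - 1" _ _ z "x # p"]) (use q in \<open>simp_all add: ctx\<close>, presburger)
    have "wins l (?n - 1) (insert {x, y} R) B"
      by (rule wins_draw[OF red_red red_blue]) (use q in \<open>simp_all add: ctx\<close>)
    moreover have "wins l (?n - 1) R (insert {x, y} B)"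
      by (rule plain_endD[of _ "q - 1" _ _ y "x # p"]) (use q in \<open>simp_all add: ctx\<close>)
    ultimately show ?thesis
      by (rule wins_draw) (use q in \<open>simp_all add: ctx\<close>)
  qed
qed

text \<open>For \<open>q \<ge> 3\<close>, Builder follows a red \<open>{x, a}\<close> by
  \<open>{a, b}\<close> rather than by a second edge at \<open>x\<close>. Each sequence of answers
  is pursued until the blue edges gained lead to one of the end positions within the budget.\<close>

lemma plain_end_odd:
  assumes "\<And>q'. q' < q \<Longrightarrow> plain_end l q'" "odd q"
  shows "plain_end l q"
  unfolding plain_end_def
proof (intro allI impI)
  fix R B x p
  assume fin: "finite (\<Union>R \<union> \<Union>B)" and path: "blue_path B (x # p)"
    and l: "l \<le> length (x # p) + q"
  obtain a b c d v w where new: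
    "distinct [a, b, c, d, v, w]" "distinct [w, v, d, c, b, a]"
    "\<forall>i\<in>{a, b, c, d, v, w}. i \<notin> set (x # p) \<and> (\<forall>j\<in>set (x # p). j \<noteq> i)"
    "\<forall>i\<in>{a, b, c, d, v, w}. \<forall>j. {i, j} \<notin> R \<and> {j, i} \<notin> R \<and> {i, j} \<notin> B \<and> {j, i} \<notin> B"
    by (rule fresh_vertices[OF fin List.finite_set, of "x # p"])
  note ctx = fin[simplified] path new[simplified] game_simps assms(1)
  let ?n = "3 * q div 2 + 2"
  have blue: "wins l (?n - 1) R (insert {x, a} B)"
    by (rule plain_endD[of _ "q - 1" _ _ a "x # p"])
      (use l odd_pos[OF assms(2)] assms(2) in \<open>simp_all add: ctx\<close>)
  show "wins l ?n R B"
  proof (cases "q = 1")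
    case True
    have red_red: "wins l (?n - 1 - 1) (insert {x, b} (insert {x, a} R)) B"
      by (rule wins_forced[of _ _ _ x c, OF wins_path[of _ "c # x # p"]])
        (use l True in \<open>simp_all add: ctx\<close>)
    have red_blue: "wins l (?n - 1 - 1) (insert {x, a} R) (insert {x, b} B)"
      by (rule wins_path[of _ "b # x # p"]) (use l True in \<open>simp_all add: ctx\<close>)
    have "wins l (?n - 1) (insert {x, a} R) B"
      by (rule wins_draw[OF red_red red_blue]) (use True in \<open>simp_all add: ctx\<close>)
    then show ?thesis
      using blue by (rule wins_draw) (simp_all add: ctx)
  next
    case False
    with assms(2) have "3 \<le> q" by presburger
    note q = this l assms(2)

    \<comment> \<open>With \<open>{a, b}\<close> red, \<open>a\<close> is saturated but already
      adjacent to \<open>x\<close> and \<open>b\<close>, so the longer branches reach it through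
      \<open>w\<close>, \<open>c\<close>, \<open>d\<close> or \<open>v\<close>.\<close>
    let ?Rab = "insert {a, b} (insert {x, a} R)"
    have "wins l (?n - 1 - 1 - 1) (insert {b, c} ?Rab) B"
      by (rule wins_forced[of _ _ _ x b, OF wins_forced[of _ _ _ b w, OF wins_forced[of _ _ _ w a, OF
            saturated_endD[OF saturated_end_if, of "q - 3" _ _ _ a "w # b # x # p" c]]]])
        (use q in \<open>simp_all add: ctx\<close>)
    moreover have "wins l (?n - 1 - 1 - 1) ?Rab (insert {b, c} B)"
    proof (rule wins_draw)
      show "wins l (?n - 1 - 1 - 1 - 1) (insert {b, d} ?Rab) (insert {b, c} B)"
        by (rule wins_forced[of _ _ _ x b, OF wins_forced[of _ _ _ c a, OF
              saturated_endD[OF saturated_end_if, of "q - 3" _ _ _ a "c # b # x # p" d]]])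
          (use q in \<open>simp_all add: ctx\<close>)
      \<comment> \<open>The blue path \<open>c\<close>, \<open>b\<close>, \<open>d\<close> is
        attached by its end \<open>c\<close> if \<open>{x, c}\<close> is blue; if it is red,
        \<open>x\<close> is saturated and \<open>{x, d}\<close> is forced.\<close>
      let ?Bcd = "insert {b, d} (insert {b, c} B)"
      show "wins l (?n - 1 - 1 - 1 - 1) ?Rab ?Bcd"
      proof (rule wins_draw)
        show "wins l (?n - 1 - 1 - 1 - 1 - 1) ?Rab (insert {x, c} ?Bcd)"
        proof (cases "q = 3")
          case True
          show ?thesis
            by (rule wins_path[of _ "d # b # c # x # p"]) (use l True in \<open>simp_all add: ctx\<close>)
        next
          case False
          with q have "5 \<le> q" by presburger
          then show ?thesis
            by - (rule wins_forced[of _ _ _ d a, OF wins_forced[of _ _ _ a w, OF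
              plain_endD[of _ "q - 5" _ _ w "a # d # b # c # x # p"]]],
              use q in \<open>simp_all add: ctx\<close>, presburger?)
        qed
        let ?Rabc = "insert {x, c} ?Rab"
        show "wins l (?n - 1 - 1 - 1 - 1 - 1) ?Rabc ?Bcd"
        proof (cases "q = 3")
          case True
          show ?thesis
            by (rule wins_forced[of _ _ _ x d, OF wins_path[of _ "c # b # d # x # p"]])
              (use l True in \<open>simp_all add: ctx\<close>)
        next
          case False
          with q have "5 \<le> q" by presburger
          note q = this q
          let ?m = "?n - 1 - 1 - 1 - 1 - 1 - 1"
          have "wins l (?m - 1) (insert {c, v} ?Rabc) (insert {x, d} ?Bcd)"
            by (rule wins_forced[of _ _ _ c w, OF wins_forced[of _ _ _ w a, OF
              saturated_endD[OF saturated_end_if, of "q - 5" _ _ _ a "w # c # b # d # x # p" v]]])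
              (use q in \<open>simp_all add: ctx\<close>, presburger?)
          moreover have "wins l (?m - 1) ?Rabc (insert {c, v} (insert {x, d} ?Bcd))"
          proof (cases "q = 5")
            case True
            then show ?thesis
              by - (rule wins_forced[of _ _ _ v a, OF
                wins_path[of _ "a # v # c # b # d # x # p"]],
                use l in \<open>simp_all add: ctx\<close>)
          next
            case False
            with q have "7 \<le> q" by presburger
            then show ?thesis
              by - (rule wins_forced[of _ _ _ v a, OF wins_forced[of _ _ _ a w, OF
                plain_endD[of _ "q - 6" _ _ w "a # v # c # b # d # x # p"]]],
                use q in \<open>simp_all add: ctx\<close>, presburger?)
          qed
          ultimately have "wins l ?m ?Rabc (insert {x, d} ?Bcd)"
            by (rule wins_draw) (use q in \<open>simp_all add: ctx\<close>)
          then show ?thesis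
            by (rule wins_forced) (use q in \<open>simp_all add: ctx\<close>)
        qed
      qed (use q in \<open>simp_all add: ctx\<close>)
    qed (use q in \<open>simp_all add: ctx\<close>)
    ultimately have red_red: "wins l (?n - 1 - 1) ?Rab B"
      by (rule wins_draw) (use q in \<open>simp_all add: ctx\<close>)

    \<comment> \<open>With \<open>{a, b}\<close> blue, a red \<open>{x, b}\<close> saturates
      \<open>x\<close>. A red \<open>{b, c}\<close> then turns \<open>{b, a}\<close> into the
      reserve edge; a blue one attaches \<open>a\<close>, \<open>b\<close>, \<open>c\<close> to
      \<open>x\<close>.\<close>
    let ?Rxab = "insert {x, b} (insert {x, a} R)" and ?Bab = "insert {a, b} B"
    have "wins l (?n - 1 - 1 - 1) ?Rxab ?Bab"
    proof (rule wins_draw)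
      show "wins l (?n - 1 - 1 - 1 - 1) ?Rxab (insert {b, c} ?Bab)"
        by (rule wins_forced[of _ _ _ x c, OF
              touched_endD[OF touched_end_if, of "q - 3" _ _ _ a "b # c # x # p"]])
          (use q in \<open>simp_all add: ctx\<close>, presburger?)
      show "wins l (?n - 1 - 1 - 1 - 1) (insert {b, c} ?Rxab) ?Bab"
        by (rule reserve_endD[OF reserve_end_if, of q _ _ _ x p c b a])
          (use q in \<open>simp_all add: ctx\<close>, presburger?)
    qed (use q in \<open>simp_all add: ctx\<close>)
    moreover have "wins l (?n - 1 - 1 - 1) (insert {x, a} R) (insert {x, b} ?Bab)"
      by (rule touched_endD[OF touched_end_if, of "q - 2" _ _ _ a "b # x # p"])
        (use q in \<open>simp_all add: ctx\<close>, presburger?)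
    ultimately have red_blue: "wins l (?n - 1 - 1) (insert {x, a} R) ?Bab"
      by (rule wins_draw) (use q in \<open>simp_all add: ctx\<close>)

    have "wins l (?n - 1) (insert {x, a} R) B"
      by (rule wins_draw[OF red_red red_blue]) (use q in \<open>simp_all add: ctx\<close>)
    then show ?thesis
      using blue by (rule wins_draw) (use q in \<open>simp_all add: ctx\<close>)
  qed
qed

lemma plain_end: "plain_end l q"
proof (induction q rule: less_induct)
  case (less q)
  show ?case
  proof (cases "even q")
    case True
    show ?thesis by (rule plain_end_even[OF less True])
  next
    case False
    show ?thesis by (rule plain_end_odd[OF less False])
  qed
qed

section \<open>Growing a path at both ends, and the upper bound\<close>

lemma reversed_path:
  assumes "blue_path B p" "p \<noteq> []" "last p = e"
  obtains p' where "blue_path B (e # p')" "set (e # p') = set p" "length (e # p') = length p"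
proof -
  have "\<exists>p'. rev p = last p # p'"
    using assms(2) by (induction p rule: rev_induct) auto
  then obtain p' where p': "rev p = e # p'"
    using assms(3) by blast
  show ?thesis
    by (rule that[of p'], unfold p'[symmetric]) (simp_all add: assms(1) blue_path_rev)
qed

text \<open>With both ends saturated the last two edges are forced, which saves one round against
  \<open>saturated_end\<close>. The vertex \<open>z\<close> is held back for the end
  \<open>e\<close>, in case two blue answers at \<open>y\<close> spoil the other end.
  \<open>x = e\<close> is allowed.\<close>

lemma wins_two_saturated_ends:
  assumes "finite (\<Union>R \<union> \<Union>B)" "blue_path B (x # p)"
    and "saturated R x" "last (x # p) = e" "saturated R e"
    and "touched R y" "touched R z" "y \<noteq> z" "{y, z} \<inter> set (x # p) = {}"
    and "l \<le> length (x # p) + q" "even q" "0 < q"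
  shows "wins l (3 * q div 2 - 1) R B"
  using assms
proof (induction q arbitrary: R B x p y rule: less_induct)
  case (less q)
  note fin = less.prems(1)
  obtain u v w and r1 r2 r3 :: nat where new:
    "distinct [u, v, w, r1, r2, r3]" "distinct [r3, r2, r1, w, v, u]"
    "\<forall>i\<in>{u, v, w, r1, r2, r3}. i \<notin> set (y # z # x # p) \<and> (\<forall>j\<in>set (y # z # x # p). j \<noteq> i)"
    "\<forall>i\<in>{u, v, w, r1, r2, r3}. \<forall>j. {i, j} \<notin> R \<and> {j, i} \<notin> R \<and> {i, j} \<notin> B \<and> {j, i} \<notin> B"
    by (rule fresh_vertices[OF fin List.finite_set, of "y # z # x # p"])
  have e: "e \<in> set (x # p)"
    using last_in_set[of "x # p"] unfolding less.prems(4) by simp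
  have "\<forall>j\<in>set (x # p). j \<noteq> v \<and> j \<noteq> w"
    using new(3) by simp
  with e have e_neq: "e \<noteq> v" "e \<noteq> w" "v \<noteq> e" "w \<noteq> e"
    by blast+
  have neq: "y \<noteq> x" "x \<noteq> y" "z \<noteq> x" "x \<noteq> z" "z \<noteq> y" "y \<notin> set p" "z \<notin> set p"
    using less.prems(8,9) by auto
  note ctx = fin[simplified] less.prems(2,3,5-8) neq e_neq new[simplified] game_simps
  let ?n = "3 * q div 2 - 1"
  show ?case
  proof (cases "q = 2")
    case True
    have path: "blue_path (insert {x, w} B) (w # x # p)"
      by (simp add: ctx)
    have last: "last (w # x # p) = e"
      using less.prems(4) by simp
    obtain p' where p': "blue_path (insert {x, w} B) (e # p')" "set (e # p') = set (w # x # p)"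
        "length (e # p') = length (w # x # p)"
      by (rule reversed_path[OF path list.distinct(2) last])
    have "wins l (?n - 1 - 1) R (insert {e, v} (insert {x, w} B))"
      by (rule wins_path[of _ "v # e # p'"])
        (use less.prems(10) True p' in \<open>auto simp: ctx\<close>)
    then have "wins l (?n - 1) R (insert {x, w} B)"
      by (rule wins_forced) (use True in \<open>simp_all add: ctx\<close>)
    then show ?thesis
      by (rule wins_forced) (use True in \<open>simp_all add: ctx\<close>)
  next
    case False
    with less.prems(11,12) have "4 \<le> q" by presburger
    note q = this less.prems(4,10,11)
    have bounds: "3 * (q - 2) div 2 - 1 \<le> ?n - 1 - 1 - 1"
      "(3 * (q - 3) + 1) div 2 \<le> ?n - 1 - 1 - 1"
      using \<open>4 \<le> q\<close> less.prems(11) by presburger+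
    note IH = less.IH[of "q - 2"]
    have red: "wins l (?n - 1) (insert {y, u} R) B"
      by (rule wins_forced[of _ _ _ x w, OF wins_forced[of _ _ _ w y, OF
            builder_forces_mono[OF IH[of _ _ y "w # x # p" u] bounds(1)]]])
        (use q in \<open>simp_all add: ctx\<close>)
    have blue_red: "wins l (?n - 1 - 1) (insert {y, v} R) (insert {y, u} B)"
      by (rule wins_forced[of _ _ _ x u, OF
            builder_forces_mono[OF IH[of _ _ y "u # x # p" v] bounds(1)]])
        (use q in \<open>simp_all add: ctx\<close>)
    \<comment> \<open>The path is reversed, and \<open>e\<close> with \<open>z\<close> continues as
      \<open>saturated_end\<close> at \<open>q - 3\<close>.\<close>
    have blue_blue: "wins l (?n - 1 - 1) R (insert {y, v} (insert {y, u} B))"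
    proof -
      let ?B = "insert {x, u} (insert {y, v} (insert {y, u} B))"
      have path: "blue_path ?B (v # y # u # x # p)"
        by (simp add: ctx)
      have last: "last (v # y # u # x # p) = e"
        using less.prems(4) by simp
      obtain p' where p': "blue_path ?B (e # p')" "set (e # p') = set (v # y # u # x # p)"
          "length (e # p') = length (v # y # u # x # p)"
        by (rule reversed_path[OF path list.distinct(2) last])
      have z: "z \<notin> set (e # p')"
        unfolding p'(2) by (simp add: ctx)
      have "wins l (?n - 1 - 1 - 1) R ?B"
        by (rule saturated_endD[OF saturated_end_if[OF plain_end] _ p'(1) less.prems(5,7) z _ bounds(2)])
          (use q p'(3) in \<open>simp_all add: ctx\<close>)
      then show ?thesis
        by (rule wins_forced) (use q in \<open>simp_all add: ctx\<close>)
    qed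
    have "wins l (?n - 1) R (insert {y, u} B)"
      by (rule wins_draw[OF blue_red blue_blue]) (use q in \<open>simp_all add: ctx\<close>)
    with red show ?thesis
      by (rule wins_draw) (use q in \<open>simp_all add: ctx\<close>)
  qed
qed

text \<open>For even \<open>l\<close>, a one-vertex path with \<open>q = l - 1\<close> meets the
  bound. For odd \<open>l\<close> this is one round too many; the opening gains it because a single
  vertex is both ends of its path.\<close>

lemma builder_wins:
  assumes "2 \<le> l"
  shows "wins l (3 * l div 2) {} {}"
proof (cases "even l")
  case True
  with assms have "3 * (l - 1) div 2 + 2 \<le> 3 * l div 2"
    by presburger
  then show ?thesis
    by (rule plain_endD[OF plain_end, where x = 0 and p = "[]", rotated -1]) (simp_all add: blue_path_def)
next
  case False
  with assms have l: "3 \<le> l" "odd l"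
    by presburger+
  let ?n = "3 * l div 2"
  note ctx = game_simps blue_path_def saturated_new touched_new
  have bounds: "3 * (l - 2) div 2 + 2 \<le> ?n - 1" "3 * (l - 1) div 2 - 1 \<le> ?n - 1 - 1"
    using l by presburger+
  have blue: "wins l (?n - 1) {} {{0, 1}}"
    by (rule plain_endD[OF plain_end, where x = 1 and p = "[0]", OF _ _ _ bounds(1)]) (use l in \<open>simp_all add: ctx\<close>)
  have red_red: "wins l (?n - 1 - 1) {{1, 2}, {0, 1}} {}"
    by (rule builder_forces_mono[OF wins_two_saturated_ends[of _ _ 1 "[]" 1 0 2] bounds(2)])
      (use l in \<open>simp_all add: ctx\<close>)
  have red_blue: "wins l (?n - 1 - 1) {{0, 1}} {{1, 2}}"
  proof (cases "l = 3")
    case True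
    have "wins l (?n - 1 - 1 - 1) {{1, 3}, {0, 1}} {{1, 2}}"
      by (rule wins_forced[of _ _ _ 1 4, OF wins_path[of _ "[4, 1, 2]"]])
        (use True in \<open>simp_all add: ctx\<close>)
    moreover have "wins l (?n - 1 - 1 - 1) {{0, 1}} {{1, 3}, {1, 2}}"
      by (rule wins_path[of _ "[3, 1, 2]"]) (use True in \<open>simp_all add: ctx\<close>)
    ultimately show ?thesis
      by (rule wins_draw) (use True in \<open>simp_all add: ctx\<close>)
  next
    case False
    with l have l: "5 \<le> l" "odd l"
      by presburger+
    have bounds: "3 * (l - 5 + 1) div 2 \<le> ?n - 1 - 1 - 1 - 1 - 1 - 1"
      "(3 * (l - 2) - 5) div 2 \<le> ?n - 1 - 1 - 1 - 1 - 1"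
      "3 * (l - 3 + 1) div 2 \<le> ?n - 1 - 1 - 1"
      using l by presburger+
    \<comment> \<open>This follows the branch of \<open>plain_end_odd\<close> with
      \<open>{a, b}\<close> blue, taking \<open>0\<close>, \<open>1\<close>, \<open>2\<close> for
      \<open>x\<close>, \<open>a\<close>, \<open>b\<close>. As no path precedes \<open>0\<close>,
      saturating it also forces \<open>{0, 4}\<close> on its other side.\<close>
    let ?R = "{{0, 2}, {0, 1}} :: nat set set"
    have "wins l (?n - 1 - 1 - 1 - 1) (insert {2, 3} ?R) {{1, 2}}"
      by (rule wins_forced[of _ _ _ 0 4, OF reserve_endD[OF reserve_end_if[OF plain_end], 
            where x = 0 and p = "[4]" and y = 3 and s = 2 and t = 1, OF _ _ _ _ _ _ _ _ _ _ _ _ bounds(2)]])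
        (use l in \<open>simp_all add: ctx\<close>)
    moreover have "wins l (?n - 1 - 1 - 1 - 1) ?R {{2, 3}, {1, 2}}"
      by (rule wins_forced[of _ _ _ 0 3, OF wins_forced[of _ _ _ 0 4, OF
            touched_endD[OF touched_end_if[OF plain_end], where x = 1 and p = "[2, 3, 0, 4]", OF _ _ _ _ bounds(1)]]])
        (use l in \<open>simp_all add: ctx\<close>)
    ultimately have "wins l (?n - 1 - 1 - 1) ?R {{1, 2}}"
      by (rule wins_draw) (use l in \<open>simp_all add: ctx\<close>)
    moreover have "wins l (?n - 1 - 1 - 1) {{0, 1}} {{0, 2}, {1, 2}}"
      by (rule touched_endD[OF touched_end_if[OF plain_end], where x = 1 and p = "[2, 0]", OF _ _ _ _ bounds(3)])
        (use l in \<open>simp_all add: ctx\<close>)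
    ultimately show ?thesis
      by (rule wins_draw) (use l in \<open>simp_all add: ctx\<close>)
  qed
  have "wins l (?n - 1) {{0, 1}} {}"
    by (rule wins_draw[OF red_red red_blue]) (use l in \<open>simp_all add: ctx\<close>)
  then show ?thesis
    using blue by (rule wins_draw) (use l in \<open>simp_all add: ctx\<close>)
qed

section \<open>Painter's strategy\<close>

definition degree :: "nat set set \<Rightarrow> nat \<Rightarrow> nat" where
  "degree R x = card {e \<in> R. x \<in> e}"

text \<open>As long as Painter avoids red cycles, \<open>m\<close> exchanges the two ends of each red path and fixes
  the vertices without red edges; its values at vertices of red degree 2 are irrelevant. The last
  clause says that a blue edge without an endpoint of red degree 2 joins the two ends of a red path,
  and that there is another red path if \<open>R\<close> has reached \<open>l div 2\<close> edges.\<close>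

definition mated :: "nat \<Rightarrow> nat set set \<Rightarrow> nat set set \<Rightarrow> (nat \<Rightarrow> nat) \<Rightarrow> bool" where
  "mated l R B m \<longleftrightarrow>
     (\<forall>x. degree R x = 0 \<longrightarrow> m x = x) \<and>
     (\<forall>x. degree R x = 1 \<longrightarrow> m x \<noteq> x \<and> degree R (m x) = 1 \<and> m (m x) = x) \<and>
     (R \<noteq> {} \<longrightarrow> (\<exists>x. degree R x = 1)) \<and>
     (\<forall>x y. x \<noteq> y \<longrightarrow> {x, y} \<in> B \<longrightarrow> degree R x \<noteq> 2 \<longrightarrow> degree R y \<noteq> 2 \<longrightarrow>
        degree R x = 1 \<and> m x = y \<and>
        (card R < l div 2 \<or> (\<exists>z. degree R z = 1 \<and> z \<noteq> x \<and> z \<noteq> y)))"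

text \<open>Beyond \<open>l div 2\<close> red edges the degree bound suffices: the
  \<open>l - 1\<close> edges of a blue path bring the total to at least
  \<open>3 * l div 2\<close>.\<close>

definition painter_safe :: "nat \<Rightarrow> nat set set \<Rightarrow> nat set set \<Rightarrow> bool" where
  "painter_safe l R B \<longleftrightarrow> finite R \<and> finite B \<and> (\<forall>e \<in> R. card e = 2) \<and>
     (\<forall>x. degree R x \<le> 2) \<and> (l div 2 < card R \<or> (\<exists>m. mated l R B m))"

lemma degree_insert:
  assumes "finite R" "{u, v} \<notin> R"
  shows "degree (insert {u, v} R) x = degree R x + (if x = u \<or> x = v then 1 else 0)"
proof (cases "x = u \<or> x = v")
  case True
  then have "{e \<in> insert {u, v} R. x \<in> e} = insert {u, v} {e \<in> R. x \<in> e}"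
    by auto
  with True assms show ?thesis
    by (simp add: degree_def)
next
  case False
  then have "{e \<in> insert {u, v} R. x \<in> e} = {e \<in> R. x \<in> e}"
    by auto
  with False show ?thesis
    by (simp add: degree_def)
qed

text \<open>Incidences are counted twice; under the degree bound only degrees 1 and 2
  contribute.\<close>

lemma handshake:
  assumes fin: "finite R" and edges: "\<forall>e \<in> R. card e = 2" and deg: "\<forall>x. degree R x \<le> 2"
  shows "finite {x. degree R x = i + 1}"
    and "2 * card R = 2 * card {x. degree R x = 2} + card {x. degree R x = 1}"
proof -
  have fin_V: "finite (\<Union>R)"
    using fin edges by (intro finite_Union) (auto intro: card_ge_0_finite)
  have zero: "degree R x = 0" if "x \<notin> \<Union>R" for x
  proof -
    from that have "{e \<in> R. x \<in> e} = {}" by auto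
    then show ?thesis by (simp only: degree_def card.empty)
  qed
  then have sub: "{x. degree R x = i + 1} \<subseteq> \<Union>R" for i
    by force
  then show fin_i: "finite {x. degree R x = i + 1}" for i
    using fin_V finite_subset by blast
  let ?S = "{x. degree R x = 2}" and ?D = "{x. degree R x = 1}"
  have SD: "?S \<subseteq> \<Union>R" "?D \<subseteq> \<Union>R"
    using sub[of 0] sub[of 1] by (simp_all add: numeral_2_eq_2)
  have "(\<Sum>x\<in>\<Union>R. degree R x) = (\<Sum>e\<in>R. 2)"
    unfolding degree_def
  proof (rule sum_multicount_gen[OF fin_V fin], rule ballI)
    fix e assume "e \<in> R"
    then have "{x \<in> \<Union>R. x \<in> e} = e" by blast
    with edges \<open>e \<in> R\<close> show "card {x \<in> \<Union>R. x \<in> e} = 2" by simp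
  qed
  moreover have "(\<Sum>x\<in>\<Union>R. degree R x) = (\<Sum>x\<in>?S \<union> ?D. degree R x)"
  proof (rule sum.mono_neutral_right[OF fin_V])
    show "?S \<union> ?D \<subseteq> \<Union>R" using SD by blast
    show "\<forall>x\<in>\<Union>R - (?S \<union> ?D). degree R x = 0"
    proof
      fix x assume "x \<in> \<Union>R - (?S \<union> ?D)"
      with deg[rule_format, of x] show "degree R x = 0" by simp
    qed
  qed
  moreover have "(\<Sum>x\<in>?S \<union> ?D. degree R x) = (\<Sum>x\<in>?S. degree R x) + (\<Sum>x\<in>?D. degree R x)"
    using fin_i[of 0] fin_i[of 1] by (intro sum.union_disjoint) (auto simp: numeral_2_eq_2)
  ultimately show "2 * card R = 2 * card ?S + card ?D"
    by simp
qed

text \<open>Two red paths, possibly single vertices, are merged, and their outer ends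
  \<open>m u\<close> and \<open>m v\<close> become mates. A blue edge without an endpoint of red
  degree 2 then joins the ends of another red path, so \<open>m u\<close> witnesses the last clause
  whatever \<open>card R\<close> is.\<close>

lemma mated_insert_red:
  assumes "finite R" "{u, v} \<notin> R" "u \<noteq> v" "degree R u \<le> 1" "degree R v \<le> 1" "m u \<noteq> v"
    and "\<forall>x. degree R x \<le> 2" "mated l R B m"
  shows "mated l (insert {u, v} R) B (m(m u := m v, m v := m u))"
proof -
  let ?R = "insert {u, v} R" and ?m = "m(m u := m v, m v := m u)"
  note deg = degree_insert[OF assms(1,2)]
  have m0: "m x = x" if "degree R x = 0" for x
    using assms(8) that unfolding mated_def by blast
  have m1: "m x \<noteq> x" "degree R (m x) = 1" "m (m x) = x" if "degree R x = 1" for x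
    using assms(8) that unfolding mated_def by blast+
  have blue: "degree R x = 1 \<and> m x = y"
    if "x \<noteq> y" "{x, y} \<in> B" "degree R x \<noteq> 2" "degree R y \<noteq> 2" for x y
    using assms(8) that unfolding mated_def by blast
  have u: "degree R u = 0 \<or> degree R u = 1" and v: "degree R v = 0 \<or> degree R v = 1"
    using assms(4,5) by linarith+
  have mm: "m (m u) = u" "m (m v) = v"
    using u v m0[of u] m0[of v] m1(3)[of u] m1(3)[of v] by auto
  have mv: "m v \<noteq> u"
  proof
    assume "m v = u"
    with mm(2) have "m u = v" by simp
    with assms(6) show False ..
  qed
  have mu_mv: "m u \<noteq> m v"
  proof
    assume "m u = m v"
    then have "m (m u) = m (m v)" by (rule arg_cong)
    with assms(3) show False unfolding mm by (rule notE)
  qed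
  \<comment> \<open>The two disjunctions say that \<open>m w\<close> is not the other endpoint of
    the new edge.\<close>
  have deg_mate: "degree ?R (m w) = 1" if "w \<in> {u, v}" "m w \<noteq> u \<or> w = u" "m w \<noteq> v \<or> w = v" for w
  proof (cases "degree R w = 0")
    case True
    with that m0[OF True] show ?thesis by (auto simp: deg)
  next
    case False
    with that(1) u v have "degree R w = 1" by auto
    with that m1(1,2)[OF this] show ?thesis by (auto simp: deg)
  qed
  have deg_mu: "degree ?R (m u) = 1" "degree ?R (m v) = 1"
    using assms(6) mv by (simp_all add: deg_mate del: One_nat_def)
  have "?m x = x" if "degree ?R x = 0" for x
  proof -
    have "x \<noteq> m u" "x \<noteq> m v" "degree R x = 0"
      using deg_mu that by (auto simp: deg split: if_splits)
    then show ?thesis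
      using m0 by simp
  qed
  moreover have "?m x \<noteq> x \<and> degree ?R (?m x) = 1 \<and> ?m (?m x) = x" if x: "degree ?R x = 1" for x
  proof (cases "x = m u \<or> x = m v")
    case True
    then show ?thesis
      using deg_mu mu_mv by auto
  next
    case False
    then have "x \<noteq> u" "x \<noteq> v"
      using x u v m0[of u] m0[of v] by (auto simp: deg)
    then have "degree R x = 1"
      using x by (simp add: deg)
    moreover have "m x \<noteq> u" "m x \<noteq> v"
      using False m1(3)[OF \<open>degree R x = 1\<close>] by metis+
    moreover have "m x \<noteq> m u" "m x \<noteq> m v"
      using m1(3)[OF \<open>degree R x = 1\<close>] mm \<open>x \<noteq> u\<close> \<open>x \<noteq> v\<close> by metis+
    ultimately show ?thesis
      using False m1[of x] by (simp add: deg)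
  qed
  moreover have "degree ?R x = 1 \<and> ?m x = y \<and>
        (card ?R < l div 2 \<or> (\<exists>z. degree ?R z = 1 \<and> z \<noteq> x \<and> z \<noteq> y))"
    if xy: "x \<noteq> y" "{x, y} \<in> B" "degree ?R x \<noteq> 2" "degree ?R y \<noteq> 2" for x y
  proof -
    have le: "degree R x \<noteq> 2" "degree R y \<noteq> 2"
      using xy(3,4) u v by (auto simp: deg split: if_splits)
    have x: "degree R x = 1" "m x = y" and y: "degree R y = 1" "m y = x"
      using blue[OF xy(1,2) le] blue[of y x] xy(1,2) le by (auto simp: insert_commute)
    have "x \<noteq> u" "x \<noteq> v" "y \<noteq> u" "y \<noteq> v"
      using xy(3,4) x y by (auto simp: deg)
    moreover from this have "x \<noteq> m u" "x \<noteq> m v" "y \<noteq> m u"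
      using x(2) y(2) mm by metis+
    ultimately show ?thesis
      using x deg_mu(1) by (auto simp: deg intro!: exI[of _ "m u"])
  qed
  ultimately show ?thesis
    using deg_mu(1) unfolding mated_def by (intro conjI allI impI) blast+
qed

lemma mated_insert_blue:
  assumes "mated l R B m"
    and "degree R u = 2 \<or> degree R v = 2 \<or>
      degree R u = 1 \<and> degree R v = 1 \<and> m u = v \<and> m v = u \<and> card R < l div 2"
  shows "mated l R (insert {u, v} B) m"
proof -
  have "degree R x = 1 \<and> m x = y \<and> (card R < l div 2 \<or> (\<exists>z. degree R z = 1 \<and> z \<noteq> x \<and> z \<noteq> y))"
    if "x \<noteq> y" "{x, y} \<in> insert {u, v} B" "degree R x \<noteq> 2" "degree R y \<noteq> 2" for x y
  proof (cases "{x, y} \<in> B")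
    case True
    with assms(1) that show ?thesis
      unfolding mated_def by blast
  next
    case False
    with that have "x = u \<and> y = v \<or> x = v \<and> y = u"
      by (simp add: doubleton_eq_iff)
    with that(3,4) assms(2) show ?thesis
      by auto
  qed
  with assms(1) show ?thesis
    unfolding mated_def by (elim conjE, intro conjI) simp_all
qed

text \<open>Painter colours an edge red unless this makes a red degree 3 or closes a red cycle; the cycle
  is closed nevertheless if it brings the number of red edges above \<open>l div 2\<close>. From then on
  everything may be blue.\<close>

lemma painter_safe_step:
  assumes safe: "painter_safe l R B" and uv: "u \<noteq> v" "{u, v} \<notin> R \<union> B"
  shows "painter_safe l (insert {u, v} R) B \<or> painter_safe l R (insert {u, v} B)"
proof -
  have fin: "finite R" "finite B" and edges: "\<forall>e \<in> R. card e = 2"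
    and deg: "\<forall>x. degree R x \<le> 2"
    using safe unfolding painter_safe_def by auto
  have new: "{u, v} \<notin> R" using uv by blast
  note deg' = degree_insert[OF fin(1) new]
  show ?thesis
  proof (cases "l div 2 < card R")
    case True
    then have "painter_safe l R (insert {u, v} B)"
      using fin edges deg unfolding painter_safe_def by simp
    then show ?thesis ..
  next
    case False
    then obtain m where m: "mated l R B m"
      using safe unfolding painter_safe_def by blast
    have m0: "m x = x" if "degree R x = 0" for x
      using m that unfolding mated_def by blast
    have m1: "m x \<noteq> x" "degree R (m x) = 1" "m (m x) = x" if "degree R x = 1" for x
      using m that unfolding mated_def by blast+
    have red: "painter_safe l (insert {u, v} R) B"
      if "degree R u \<le> 1" "degree R v \<le> 1"
        "l div 2 < card (insert {u, v} R) \<or> (\<exists>m. mated l (insert {u, v} R) B m)"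
      using that fin edges deg uv(1) unfolding painter_safe_def by (auto simp: deg')
    consider "degree R u = 2 \<or> degree R v = 2" | "degree R u \<le> 1" "degree R v \<le> 1" "m u = v" 
      | "degree R u \<le> 1" "degree R v \<le> 1" "m u \<noteq> v"
      using deg[rule_format, of u] deg[rule_format, of v] by linarith
    then show ?thesis
    proof cases
      case 1
      then have "mated l R (insert {u, v} B) m"
        using m by (intro mated_insert_blue) auto
      then have "painter_safe l R (insert {u, v} B)"
        using fin edges deg unfolding painter_safe_def by (intro conjI) auto
      then show ?thesis ..
    next
      case 2
      show ?thesis
      proof (cases "card R < l div 2")
        case True
        have "degree R u = 1" "degree R v = 1" "m v = u"
          using 2 m0[of u] m1[of u] uv(1) by (auto simp: le_Suc_eq)
        then have "mated l R (insert {u, v} B) m"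
          using m True 2(3) by (intro mated_insert_blue) auto
        then have "painter_safe l R (insert {u, v} B)"
          using fin edges deg unfolding painter_safe_def by (intro conjI) auto
        then show ?thesis ..
      next
        \<comment> \<open>Now \<open>card R = l div 2\<close>: the red edge pushes the count above
          it, and the first alternative of \<open>painter_safe\<close> takes over.\<close>
        case False
        then have "l div 2 < card (insert {u, v} R)"
          using fin(1) new by simp
        with red[OF 2(1,2)] show ?thesis by simp
      qed
    next
      case 3
      have "mated l (insert {u, v} R) B (m(m u := m v, m v := m u))"
        by (rule mated_insert_red[OF fin(1) new uv(1) 3 deg m])
      with red[OF 3(1,2)] show ?thesis by auto
    qed
  qed
qed

section \<open>Counting the edges once a blue path exists\<close>

lemma has_copy_path_graphE:
  assumes "has_copy (path_graph l) B"
  obtains f :: "nat \<Rightarrow> nat" where "inj_on f {..<l}" "\<forall>i. Suc i < l \<longrightarrow> {f i, f (Suc i)} \<in> B"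
proof -
  obtain f where f: "inj_on f {..<l}" "\<forall>e\<in>{{i, Suc i} | i. Suc i < l}. f ` e \<in> B"
    using assms unfolding has_copy_def path_graph_def by auto
  show ?thesis
  proof (rule that[OF f(1)], intro allI impI)
    fix i assume "Suc i < l"
    then have "f ` {i, Suc i} \<in> B" using f(2) by blast
    then show "{f i, f (Suc i)} \<in> B" by simp
  qed
qed

lemma card_blue_path:
  assumes "has_copy (path_graph l) B" "finite B"
  shows "l - 1 \<le> card B"
proof -
  obtain f :: "nat \<Rightarrow> nat" where inj: "inj_on f {..<l}"
    and edge: "\<forall>i. Suc i < l \<longrightarrow> {f i, f (Suc i)} \<in> B"
    using assms(1) by (rule has_copy_path_graphE)
  have "inj_on (\<lambda>i. {f i, f (Suc i)}) {..<l - 1}"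
  proof (rule inj_onI)
    fix i j assume ij: "i \<in> {..<l - 1}" "j \<in> {..<l - 1}" "{f i, f (Suc i)} = {f j, f (Suc j)}"
    then have "f i = f j \<or> f i = f (Suc j) \<and> f (Suc i) = f j"
      by (auto simp: doubleton_eq_iff)
    with ij(1,2) show "i = j"
      by (auto simp: inj_on_eq_iff[OF inj] less_diff_conv)
  qed
  then have "card ((\<lambda>i. {f i, f (Suc i)}) ` {..<l - 1}) = l - 1"
    by (simp add: card_image)
  moreover have "(\<lambda>i. {f i, f (Suc i)}) ` {..<l - 1} \<subseteq> B"
    using edge by auto
  ultimately show ?thesis
    using card_mono[OF assms(2)] by metis
qed

lemma no_red_star:
  assumes "finite R" "\<forall>x. degree R x \<le> 2"
  shows "\<not> has_copy (star 3) R"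
proof
  assume "has_copy (star 3) R"
  then obtain f :: "nat \<Rightarrow> nat" where inj: "inj_on f {0..3}"
    and edges: "\<forall>e\<in>{{0, i} | i. i \<in> {1..3}}. f ` e \<in> R"
    unfolding has_copy_def star_def by auto
  have edge: "f ` {0, i} \<in> R" if "i \<in> {1..3}" for i
    using edges that by blast
  have "inj_on (\<lambda>i. f ` {0, i}) {1..3}"
  proof (rule inj_onI)
    fix i j :: nat assume ij: "i \<in> {1..3}" "j \<in> {1..3}" "f ` {0, i} = f ` {0, j}"
    then have "f i = f j"
      by (auto simp: doubleton_eq_iff)
    with ij show "i = j"
      using inj_onD[OF inj, of i j] by simp
  qed
  then have "card ((\<lambda>i. f ` {0, i}) ` {1..3}) = 3"
    by (simp add: card_image)
  moreover have "(\<lambda>i. f ` {0, i}) ` {1..3} \<subseteq> {e \<in> R. f 0 \<in> e}"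
    using edge by auto
  then have "card ((\<lambda>i. f ` {0, i}) ` {1..3}) \<le> degree R (f 0)"
    unfolding degree_def using assms(1) by (intro card_mono) auto
  ultimately show False
    using assms(2)[rule_format, of "f 0"] by simp
qed

text \<open>Let \<open>S\<close> and \<open>D\<close> be the sets of vertices of red degree 2 and 1, so that
  \<open>2 * card R = 2 * card S + card D\<close>. Vertices of \<open>S\<close> cover at most \<open>2 * card S\<close> edges of the blue
  path, and the uncovered edges form a matching in \<open>D\<close>. If \<open>card R \<le> l div 2\<close>, this leaves
  only \<open>card D = 2\<close> with an uncovered edge on \<open>D\<close>, which the last clause of \<open>mated\<close> excludes.\<close>

lemma card_red_of_blue_path:
  assumes safe: "painter_safe l R B" and path: "has_copy (path_graph l) B" and l: "2 \<le> l"
  shows "l div 2 < card R"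
proof (rule ccontr)
  assume not_many: "\<not> l div 2 < card R"
  have fin: "finite R" and edges: "\<forall>e \<in> R. card e = 2" and deg: "\<forall>x. degree R x \<le> 2"
    using safe unfolding painter_safe_def by auto
  obtain m where m: "mated l R B m"
    using safe not_many unfolding painter_safe_def by blast
  have mate: "m x \<noteq> x" "degree R (m x) = 1" "m (m x) = x" if "degree R x = 1" for x
    using m that unfolding mated_def by blast+
  have blue: "degree R x = 1 \<and> m x = y \<and> (card R < l div 2 \<or> (\<exists>z. degree R z = 1 \<and> z \<noteq> x \<and> z \<noteq> y))"
    if "x \<noteq> y" "{x, y} \<in> B" "degree R x \<noteq> 2" "degree R y \<noteq> 2" for x y
    using m that unfolding mated_def by blast
  obtain f :: "nat \<Rightarrow> nat" where inj: "inj_on f {..<l}"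
    and edges_B: "\<forall>i. Suc i < l \<longrightarrow> {f i, f (Suc i)} \<in> B"
    using path by (rule has_copy_path_graphE)
  note edge = edges_B[rule_format]
  define S where "S = {x. degree R x = 2}"
  define D where "D = {x. degree R x = 1}"
  define I where "I = {i. Suc i < l \<and> f i \<in> S}"
  define J where "J = {i. Suc i < l \<and> f (Suc i) \<in> S}"
  define U where "U = {i. Suc i < l \<and> f i \<notin> S \<and> f (Suc i) \<notin> S}"
  have fin_SD: "finite S" "finite D"
    using handshake(1)[OF fin edges deg, of 1] handshake(1)[OF fin edges deg, of 0]
    unfolding S_def D_def by (simp_all add: numeral_2_eq_2)
  have shake: "2 * card R = 2 * card S + card D"
    unfolding S_def D_def by (rule handshake(2)[OF fin edges deg])
  have fin_idx: "finite I" "finite J" "finite U"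
    unfolding I_def J_def U_def by (auto intro: finite_subset[of _ "{..<l}"])
  have neq: "f i \<noteq> f (Suc i)" if "Suc i < l" for i
    using inj_onD[OF inj, of i "Suc i"] that by auto
  have unsat: "f i \<in> D" "f (Suc i) \<in> D" "m (f i) = f (Suc i)" "m (f (Suc i)) = f i"
      "card R < l div 2 \<or> (\<exists>z \<in> D. z \<noteq> f i \<and> z \<noteq> f (Suc i))" if "i \<in> U" for i
  proof -
    have i: "Suc i < l" "degree R (f i) \<noteq> 2" "degree R (f (Suc i)) \<noteq> 2"
      using that unfolding U_def S_def by auto
    note b = blue[OF neq[OF i(1)] edge[OF i(1)] i(2,3)]
    show "f i \<in> D" "m (f i) = f (Suc i)"
        "card R < l div 2 \<or> (\<exists>z \<in> D. z \<noteq> f i \<and> z \<noteq> f (Suc i))"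
      using b unfolding D_def by blast+
    show "f (Suc i) \<in> D" "m (f (Suc i)) = f i"
      using b mate[of "f i"] unfolding D_def by auto
  qed
  have inj_idx: "inj_on f {i. Suc i < l}" "inj_on (\<lambda>i. f (Suc i)) {i. Suc i < l}"
    using inj by (auto simp: inj_on_def)
  have "card I \<le> card S"
    by (rule card_inj_on_le[OF inj_on_subset[OF inj_idx(1)] _ fin_SD(1)]) (auto simp: I_def)
  moreover have "card J \<le> card S"
    by (rule card_inj_on_le[OF inj_on_subset[OF inj_idx(2)] _ fin_SD(1)]) (auto simp: J_def)
  moreover have "2 * card U \<le> card D"
  proof -
    have U_sub: "U \<subseteq> {i. Suc i < l}" unfolding U_def by auto
    \<comment> \<open>Uncovered edges share no vertex: a common one gives \<open>i = Suc j\<close>,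
      while uniqueness of its mate gives \<open>Suc i = j\<close>.\<close>
    have "f ` U \<inter> (\<lambda>i. f (Suc i)) ` U = {}"
    proof (rule ccontr)
      assume "f ` U \<inter> (\<lambda>i. f (Suc i)) ` U \<noteq> {}"
      then obtain i j where ij: "i \<in> U" "j \<in> U" "f i = f (Suc j)" by auto
      then have "i = Suc j"
        using inj_onD[OF inj, of i "Suc j"] unfolding U_def by auto
      have "f (Suc i) = f j"
        using unsat(3)[OF ij(1)] unsat(4)[OF ij(2)] ij(3) by simp
      then have "Suc i = j"
        using inj_onD[OF inj, of "Suc i" j] ij(1,2) unfolding U_def by auto
      with \<open>i = Suc j\<close> show False by simp
    qed
    then have "card (f ` U \<union> (\<lambda>i. f (Suc i)) ` U) = card (f ` U) + card ((\<lambda>i. f (Suc i)) ` U)"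
      using fin_idx(3) by (intro card_Un_disjoint) auto
    also have "\<dots> = card U + card U"
      using card_image[OF inj_on_subset[OF inj_idx(1) U_sub]]
        card_image[OF inj_on_subset[OF inj_idx(2) U_sub]] by (rule arg_cong2)
    finally have "card (f ` U \<union> (\<lambda>i. f (Suc i)) ` U) = card U + card U" .
    moreover have "f ` U \<union> (\<lambda>i. f (Suc i)) ` U \<subseteq> D"
      using unsat(1,2) by auto
    ultimately show ?thesis
      using card_mono[OF fin_SD(2), of "f ` U \<union> (\<lambda>i. f (Suc i)) ` U"] by simp
  qed
  moreover have "l - 1 \<le> card I + card J + card U"
  proof -
    have "{..<l - 1} = I \<union> J \<union> U"
      unfolding I_def J_def U_def by auto
    then have "l - 1 = card (I \<union> J \<union> U)"
      by (metis card_lessThan)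
    also have "\<dots> \<le> card I + card J + card U"
      by (meson add_mono_thms_linordered_semiring(3) card_Un_le le_trans)
    finally show ?thesis .
  qed
  moreover have D2: "2 \<le> card D"
  proof -
    have "R \<noteq> {}"
    proof
      assume "R = {}"
      then have "degree R x = 0" for x
        by (simp add: degree_def)
      with blue[OF neq[of 0] edge[of 0]] l show False by simp
    qed
    then obtain x where x: "degree R x = 1"
      using m unfolding mated_def by blast
    then have "{x, m x} \<subseteq> D"
      using mate unfolding D_def by simp
    then have "card {x, m x} \<le> card D"
      by (rule card_mono[OF fin_SD(2)])
    with mate(1)[OF x] show ?thesis by simp
  qed
  \<comment> \<open>From \<open>l - 1 \<le> 2 * card S + card U\<close> and
    \<open>2 * card U \<le> card D\<close> follows
    \<open>card D \<le> 2 * (2 * card R - l + 1) \<le> 2\<close> over the integers.\<close>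
  ultimately have bounds: "card D = 2" "l div 2 \<le> card R" "0 < card U"
    using shake not_many l by linarith+
  then obtain i where i: "i \<in> U"
    by (auto simp: card_gt_0_iff)
  then obtain z where "z \<in> D" "z \<noteq> f i" "z \<noteq> f (Suc i)"
    using unsat(5) bounds(2) by fastforce
  then have "{z, f i, f (Suc i)} \<subseteq> D"
    using unsat(1,2)[OF i] by simp
  then have "card {z, f i, f (Suc i)} \<le> card D"
    by (rule card_mono[OF fin_SD(2)])
  moreover have "f i \<noteq> f (Suc i)"
    using neq i unfolding U_def by blast
  ultimately show False
    using bounds(1) \<open>z \<noteq> f i\<close> \<open>z \<noteq> f (Suc i)\<close> by simp
qed

text \<open>Every round adds a new edge, so \<open>card R + card B\<close> counts the rounds played;
  the bound holds at any safe position where Builder has won, and each step keeps the position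
  safe.\<close>

lemma painter_survives:
  assumes "builder_forces (star 3) (path_graph l) n R B"
    and "painter_safe l R B" "R \<inter> B = {}" "2 \<le> l"
  shows "3 * l div 2 \<le> card R + card B + n"
  using assms(1-3)
proof (induction n arbitrary: R B)
  have over: "3 * l div 2 \<le> card R + card B"
    if "has_copy (star 3) R \<or> has_copy (path_graph l) B" "painter_safe l R B" for R B
  proof -
    have "\<not> has_copy (star 3) R"
      using that(2) no_red_star unfolding painter_safe_def by blast
    with that(1) have path: "has_copy (path_graph l) B" by blast
    have "l - 1 \<le> card B"
      using card_blue_path[OF path] that(2) unfolding painter_safe_def by blast
    with card_red_of_blue_path[OF that(2) path assms(4)] show ?thesis
      using assms(4) by linarith
  qed
  {
    case 0
    with over show ?case by (simp add: builder_forces.simps)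
  next
    case (Suc n)
    show ?case
    proof (cases "has_copy (star 3) R \<or> has_copy (path_graph l) B")
      case True
      with over Suc.prems(2) show ?thesis by fastforce
    next
      case False
      then obtain u v where uv: "u \<noteq> v" "{u, v} \<notin> R \<union> B"
        and next_pos: "builder_forces (star 3) (path_graph l) n (insert {u, v} R) B"
          "builder_forces (star 3) (path_graph l) n R (insert {u, v} B)"
        using Suc.prems(1) by (auto simp: builder_forces.simps)
      have fin: "finite R" "finite B"
        using Suc.prems(2) unfolding painter_safe_def by auto
      from painter_safe_step[OF Suc.prems(2) uv] show ?thesis
      proof
        assume "painter_safe l (insert {u, v} R) B"
        from Suc.IH[OF next_pos(1) this] uv(2) Suc.prems(3) fin show ?thesis by simp
      next
        assume "painter_safe l R (insert {u, v} B)"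
        from Suc.IH[OF next_pos(2) this] uv(2) Suc.prems(3) fin show ?thesis by simp
      qed
    qed
  }
qed

lemma painter_safe_empty: "painter_safe l {} {}"
  unfolding painter_safe_def mated_def degree_def by auto

theorem theorem1p1:
  fixes l :: nat
  assumes "l \<ge> 2"
  shows "online_ramsey (star 3) (path_graph l) = enat ((3 * l) div 2)"
  unfolding online_ramsey_def
proof (rule antisym)
  show "Inf {enat n | n. wins l n {} {}} \<le> enat (3 * l div 2)"
    using builder_wins[OF assms] by (intro Inf_lower) blast
  show "enat (3 * l div 2) \<le> Inf {enat n | n. wins l n {} {}}"
  proof (rule Inf_greatest)
    fix k assume "k \<in> {enat n | n. wins l n {} {}}"
    then obtain n where n: "k = enat n" "wins l n {} {}" by blast
    from painter_survives[OF n(2) painter_safe_empty _ assms] n(1)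
    show "enat (3 * l div 2) \<le> k" by simp
  qed
qed

end
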